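(* Let $p$ be a prime with $p\equiv 7 \pmod 8$. Suppose that $r$ is an integer such that $1\leq r<8p$, $rp\equiv 1\pmod 8$, and $\gcd(r,p)=1$. Then for all integers $n\geq 0$ and $\alpha\geq 0$, $$ped\left(p^{2\alpha+2}n+\frac{r\,p^{2\alpha+1}-1}{8}\right)\equiv 0 \pmod 8.$$
   Context: For an integer $n\ge 0$, $ped(n)$ denotes the number of partitions of $n$ in which the even parts are distinct (odd parts are unrestricted). Its generating function is $$\sum_{n=0}^{\infty}ped(n)q^n=\prod_{m=1}^{\infty}\frac{1-q^{4m}}{1-q^m}.$$ *)

theory Defs
  imports "HOL-Library.Multiset" "HOL-Number_Theory.Number_Theory"
begin

text \<open>A partition of \<open>n\<close> is represented as the finite multiset of its (positive) parts.\<close>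

definition partition_of :: "nat \<Rightarrow> nat multiset \<Rightarrow> bool" where
  "partition_of n P \<longleftrightarrow> 0 \<notin># P \<and> sum_mset P = n"

definition ped :: "nat \<Rightarrow> nat" where
  "ped n = card {P. partition_of n P \<and> (\<forall>k. even k \<longrightarrow> count P k \<le> 1)}"

end

theory Submission
  imports Defs "HOL-Computational_Algebra.Formal_Power_Series"
begin

text \<open>
  Two identities of Gauss express \<open>\<phi>(-q) = 1 + 2 \<Sum>\<^sub>s\<^sub>\<ge>\<^sub>1 (-1)^s q^(s^2)\<close> and
  \<open>\<psi>(-q) = \<Sum>\<^sub>s\<^sub>\<ge>\<^sub>0 (-q)^(s(s+1)/2)\<close> as infinite products, and comparing products gives
  \<open>\<Sum> ped(n) q^n = \<psi>(-q) / \<phi>(-q)\<close>. With \<open>\<phi>(-q) = 1 + 2 S\<close> the right-hand side is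
  \<open>\<psi>(-q) (1 - 2 S + 4 S^2)\<close> modulo 8, and \<open>S^2\<close> is \<open>S(q^2)\<close> modulo 2. So if 8 does not divide
  \<open>ped(n)\<close>, then \<open>8 n + 1\<close> has the form \<open>x^2 + 8 y^2\<close> or \<open>x^2 + 16 y^2\<close>. For \<open>p\<close> congruent to 7
  modulo 8 neither -1 nor -2 is a quadratic residue, so such a number is never exactly divisible
  by an odd power of \<open>p\<close>.

  Gauss's identities are used only modulo powers of \<open>q\<close>, as consequences of finite identities in
  the style of Shanks, which are proved by telescoping.
\<close>

unbundle fps_syntax

section \<open>Finite forms of two identities of Gauss\<close>

text \<open>Here \<open>v j\<close> stands for the inverse of \<open>1 + x ^ Suc j\<close>, so
  \<open>Q 0 n\<close> is a partial product of Gauss's product for the theta series on the left, and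
  every term of the error sum carries a power of \<open>x\<close> of at least \<open>n + 1\<close>.
  Passing from \<open>n\<close> to \<open>n + 1\<close> changes each error term by a difference in
  \<open>s\<close>, so the induction step telescopes.\<close>

lemma square_theta_finite:
  fixes x :: "'a :: comm_ring_1" and v :: "nat \<Rightarrow> 'a"
  assumes v: "\<And>j. (1 + x ^ Suc j) * v j = 1"
  defines "Q \<equiv> \<lambda>s n. \<Prod>j\<in>{s..<n}. (1 - x ^ Suc j) * v j"
  shows "1 + 2 * (\<Sum>s<n. (- 1) ^ Suc s * x ^ ((Suc s)\<^sup>2)) =
    Q 0 n + 2 * (\<Sum>s<n. (- 1) ^ Suc s * (Q (Suc s) n * x ^ (Suc n * Suc s) * v s))"
proof (induction n)
  case 0
  then show ?case by (simp add: Q_def)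
next
  case (Suc n)
  \<comment> \<open>\<open>G\<close> is the telescoping certificate for \<open>T (Suc n) s - T n s\<close>.\<close>
  define G where "G s = - ((- 1) ^ s * (Q s n * x ^ (Suc n * Suc s) * v n))" for s
  define T where "T n s = (- 1) ^ Suc s * (Q (Suc s) n * x ^ (Suc n * Suc s) * v s)" for n s
  have QSuc: "Q s (Suc n) = Q s n * ((1 - x ^ Suc n) * v n)" if "s \<le> n" for s
    using that by (simp add: Q_def)
  have Qhd: "Q s n = (1 - x ^ Suc s) * v s * Q (Suc s) n" if "s < n" for s
    using that by (simp add: Q_def prod.atLeast_Suc_lessThan)
  have step: "T (Suc n) s - T n s = G (Suc s) - G s" if "s < n" for s
  proof -
    define a b m q where "a = x ^ Suc s" and "b = x ^ Suc n"
      and "m = x ^ (Suc n * Suc s)" and "q = Q (Suc s) n"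
    have pw: "x ^ (Suc (Suc n) * Suc s) = m * a" "x ^ (Suc n * Suc (Suc s)) = m * b"
      unfolding m_def a_def b_def power_add[symmetric]
      by (simp_all add: algebra_simps del: power_Suc)
    \<comment> \<open>The right side is arranged so that the relations for \<open>v s\<close> and
      \<open>v n\<close> enter only through two subexpressions, which equal 1 and 0.\<close>
    have "q * ((1 - b) * v n) * (m * a) * v s - q * m * v s
        = - (q * (m * b) * v n) * (v s + a * v s) - (1 - a) * v s * q * m * v n
          + q * m * v s * (v n + b * v n - 1)"
      by (simp add: algebra_simps)
    also have "v s + a * v s = 1"
      using v[of s] by (simp add: a_def algebra_simps)
    also have "v n + b * v n - 1 = 0"
      using v[of n] by (simp add: b_def algebra_simps)
    finally have "q * ((1 - b) * v n) * (m * a) * v s - q * m * v s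
        = - (q * (m * b) * v n) - (1 - a) * v s * q * m * v n" by simp
    hence eq: "(- 1) ^ Suc s * (q * ((1 - b) * v n) * (m * a) * v s - q * m * v s)
        = (- 1) ^ Suc s * (- (q * (m * b) * v n) - (1 - a) * v s * q * m * v n)"
      by (rule arg_cong)
    have "T (Suc n) s - T n s = (- 1) ^ Suc s * (q * ((1 - b) * v n) * (m * a) * v s - q * m * v s)"
      using that unfolding T_def pw by (simp add: QSuc q_def b_def m_def right_diff_distrib del: power_Suc)
    also note eq
    also have "(- 1) ^ Suc s * (- (q * (m * b) * v n) - (1 - a) * v s * q * m * v n) = G (Suc s) - G s"
      unfolding G_def pw Qhd[OF that] q_def[symmetric] m_def[symmetric] a_def[symmetric]
      by (simp add: algebra_simps)
    finally show ?thesis .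
  qed
  have "(\<Sum>s<n. T (Suc n) s) - (\<Sum>s<n. T n s) = G n - G 0"
    by (simp add: step sum_lessThan_telescope flip: sum_subtractf)
  \<comment> \<open>The upper boundary of the telescoping sum and the new top error term combine to
    the next square term; the lower boundary \<open>G 0\<close> accounts for the change of
    \<open>Q 0 n\<close>.\<close>
  moreover have "T (Suc n) n + G n = (- 1) ^ Suc n * x ^ ((Suc n)\<^sup>2)"
  proof -
    have pw: "x ^ (Suc (Suc n) * Suc n) = x ^ ((Suc n)\<^sup>2) * x ^ Suc n"
      "x ^ (Suc n * Suc n) = x ^ ((Suc n)\<^sup>2)"
      unfolding power_add[symmetric] by (simp_all add: power2_eq_square algebra_simps del: power_Suc)
    have "T (Suc n) n + G n = (- 1) ^ Suc n * x ^ ((Suc n)\<^sup>2) * ((1 + x ^ Suc n) * v n)"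
      unfolding T_def G_def pw by (simp add: Q_def algebra_simps del: power_Suc) (simp add: algebra_simps)
    thus ?thesis by (simp only: v mult_1_right)
  qed
  moreover have "Q 0 (Suc n) - Q 0 n = 2 * G 0"
  proof -
    have "Q 0 (Suc n) - Q 0 n = Q 0 n * ((1 - x ^ Suc n) * v n - (1 + x ^ Suc n) * v n)"
      by (simp add: QSuc v right_diff_distrib del: power_Suc)
    thus ?thesis by (simp add: G_def algebra_simps)
  qed
  ultimately have eqs: "(\<Sum>s<n. T (Suc n) s) = (\<Sum>s<n. T n s) + G n - G 0"
      "T (Suc n) n = (- 1) ^ Suc n * x ^ ((Suc n)\<^sup>2) - G n" "Q 0 (Suc n) = Q 0 n + 2 * G 0"
    by (simp_all only: algebra_simps)
  have "Q 0 (Suc n) + 2 * (\<Sum>s<Suc n. T (Suc n) s)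
    = Q 0 n + 2 * (\<Sum>s<n. T n s) + 2 * ((- 1) ^ Suc n * x ^ ((Suc n)\<^sup>2))"
    unfolding sum.lessThan_Suc eqs by (simp only: algebra_simps)
  with Suc.IH show ?case
    unfolding T_def by (simp add: algebra_simps)
qed

text \<open>With \<open>w j\<close> the inverse of \<open>1 - z ^ (2 * j + 1)\<close>, the term
  \<open>s = 0\<close> on the right is a partial product of Gauss's product for the triangular
  series, and all other terms have order at least \<open>2 * n + 1\<close>. Telescoping in
  \<open>s\<close> again gives the induction step.\<close>

lemma triangular_theta_finite:
  fixes z :: "'a :: comm_ring_1" and w :: "nat \<Rightarrow> 'a"
  assumes w: "\<And>j. (1 - z ^ (2 * j + 1)) * w j = 1"
  defines "P \<equiv> \<lambda>s n. \<Prod>j\<in>{s..<n}. (1 - z ^ (2 * j + 2)) * w j"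
  shows "(\<Sum>s<2 * n. z ^ (s * (s + 1) div 2)) = (\<Sum>s<n. P s n * z ^ (s * (2 * n + 1)))"
proof (induction n)
  case 0
  then show ?case by simp
next
  case (Suc n)
  define T where "T n s = P s n * z ^ (s * (2 * n + 1))" for n s
  define G where "G s = (case s of 0 \<Rightarrow> 0
    | Suc t \<Rightarrow> P t n * w n * z ^ (s * (2 * n + 1)) * (1 - z ^ (2 * t + 1)))" for s
  have PSuc: "P s (Suc n) = P s n * ((1 - z ^ (2 * n + 2)) * w n)" if "s \<le> n" for s
    using that by (simp add: P_def)
  have Phd: "P s n = (1 - z ^ (2 * s + 2)) * w s * P (Suc s) n" if "s < n" for s
    using that by (simp add: P_def prod.atLeast_Suc_lessThan)
  have step: "T (Suc n) s - T n s = G (Suc s) - G s" if "s \<le> n" for s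
  proof -
    define m c where "m = z ^ (s * (2 * n + 1))" and "c = z ^ (2 * n + 1)"
    have Gs: "G s = P s n * w n * m * (1 - z ^ (2 * s))"
    proof (cases s)
      case (Suc t)
      hence "t < n" using that by simp
      have "G s = P s n * w n * m * (1 - z ^ (2 * t + 2)) * ((1 - z ^ (2 * t + 1)) * w t)"
        unfolding G_def Suc by (simp only: nat.case Phd[OF \<open>t < n\<close>] m_def Suc ac_simps)
      thus ?thesis by (simp only: w) (simp add: Suc)
    qed (simp add: G_def)
    have pw: "z ^ (s * (2 * Suc n + 1)) = m * z ^ (2 * s)"
      "z ^ (Suc s * (2 * n + 1)) = m * c" "z ^ (2 * n + 2) = z * c" "z ^ (2 * s + 1) = z * z ^ (2 * s)"
      by (simp_all add: m_def c_def algebra_simps flip: power_add power_Suc)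
    have "T (Suc n) s - T n s = P s n * m * ((1 - z * c) * w n * z ^ (2 * s) - 1)"
      unfolding T_def PSuc[OF that] pw m_def[symmetric] by (simp only: algebra_simps mult_1_left mult_1_right)
    also have "\<dots> = P s n * m * ((1 - z * c) * w n * z ^ (2 * s) - (1 - c) * w n)"
      by (simp only: w[of n, folded c_def])
    also have "\<dots> = P s n * m * (w n * z ^ (2 * s) - w n * c * (z * z ^ (2 * s)) - w n + w n * c)"
      by (simp only: algebra_simps mult_1_left mult_1_right)
    also have "\<dots> = P s n * w n * (m * c) * (1 - z ^ (2 * s + 1)) - P s n * w n * m * (1 - z ^ (2 * s))"
      unfolding pw by (simp add: algebra_simps)
    also have "\<dots> = G (Suc s) - G s"
      unfolding Gs by (simp add: G_def pw(2)[symmetric])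
    finally show ?thesis .
  qed
  \<comment> \<open>The old sum is extended by \<open>s = n\<close>: this extra term and
    \<open>G (Suc n)\<close> supply the two new triangular powers, of index \<open>2 * n\<close> and
    \<open>2 * n + 1\<close>.\<close>
  have "(\<Sum>s<Suc n. T (Suc n) s) - (\<Sum>s<Suc n. T n s) = (\<Sum>s<Suc n. G (Suc s) - G s)"
    by (subst sum_subtractf[symmetric], rule sum.cong) (auto simp: step)
  also have "\<dots> = G (Suc n) - G 0"
    by (rule sum_lessThan_telescope)
  also have "\<dots> = z ^ (Suc n * (2 * n + 1)) * ((1 - z ^ (2 * n + 1)) * w n)"
    by (simp add: G_def P_def algebra_simps)
  also have "\<dots> = z ^ (Suc n * (2 * n + 1))"
    by (simp only: w mult_1_right)
  finally have "(\<Sum>s<Suc n. T (Suc n) s) = (\<Sum>s<n. T n s) + z ^ (n * (2 * n + 1)) + z ^ (Suc n * (2 * n + 1))"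
    by (simp add: T_def P_def algebra_simps)
  moreover have "2 * n * (2 * n + 1) div 2 = n * (2 * n + 1)"
    by simp
  moreover have "Suc (2 * n) * (Suc (2 * n) + 1) div 2 = Suc n * (2 * n + 1)"
  proof -
    have "Suc (2 * n) * (Suc (2 * n) + 1) = 2 * (Suc n * (2 * n + 1))" by (simp add: algebra_simps)
    thus ?thesis by simp
  qed
  ultimately show ?case
    using Suc.IH unfolding T_def by (simp add: algebra_simps)
qed

section \<open>The generating function as a quotient of theta series\<close>

lemma fps_X_power_dvd_iff:
  fixes f :: "'a :: comm_ring_1 fps"
  shows "fps_X ^ n dvd f \<longleftrightarrow> (\<forall>i<n. f $ i = 0)"
proof
  assume "\<forall>i<n. f $ i = 0"
  hence "f = fps_X ^ n * fps_shift n f"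
    by (intro fps_ext) (auto simp: fps_X_power_mult_nth)
  thus "fps_X ^ n dvd f" by (rule dvdI)
qed (auto simp: fps_X_power_mult_nth elim!: dvdE)

text \<open>The terms of the convolution pair off under \<open>i \<mapsto> n - i\<close>; only the
  middle term is unpaired, and it vanishes by assumption. This is the coefficient form of
  \<open>f(q)^2 = f(q^2)\<close> modulo 2 for the case at hand.\<close>

lemma even_fps_square_nth:
  fixes f :: "int fps"
  assumes "\<And>i. n = 2 * i \<Longrightarrow> f $ i = 0"
  shows "even ((f * f) $ n)"
proof -
  let ?g = "\<lambda>i. f $ i * f $ (n - i)"
  let ?L = "{i. 2 * i < n}" and ?M = "{i. 2 * i = n}" and ?R = "{i. i \<le> n \<and> n < 2 * i}"
  have fin: "finite ?L" "finite ?M" "finite ?R"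
    by (auto intro: finite_subset[of _ "{..n}"])
  have disj: "?L \<inter> ?M = {}" "(?L \<union> ?M) \<inter> ?R = {}" by auto
  have "{0..n} = ?L \<union> ?M \<union> ?R" by auto
  hence "(f * f) $ n = sum ?g (?L \<union> ?M \<union> ?R)"
    by (simp only: fps_mult_nth)
  also have "\<dots> = sum ?g ?L + sum ?g ?M + sum ?g ?R"
    using fin disj by (simp only: sum.union_disjoint finite_Un simp_thms)
  also have "sum ?g ?R = sum ?g ?L"
    by (rule sum.reindex_bij_witness[of _ "\<lambda>i. n - i" "\<lambda>i. n - i"]) auto
  also have "sum ?g ?M = 0"
    using assms by (intro sum.neutral) auto
  finally show ?thesis by simp
qed

text \<open>For injective \<open>f\<close> this is the sum of \<open>(-q) ^ f s\<close> over all
  \<open>s\<close>. Since a square has the parity of its root, positive squares give the series S;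
  triangular numbers give \<open>\<psi>(-q)\<close>.\<close>

definition signed_series :: "(nat \<Rightarrow> nat) \<Rightarrow> int fps" where
  "signed_series f = Abs_fps (\<lambda>i. if i \<in> range f then (- 1) ^ i else 0)"

text \<open>Strict monotonicity gives \<open>s \<le> f s\<close>, so the first \<open>m\<close>
  terms contain every exponent below \<open>n\<close>, each exactly once.\<close>

lemma signed_series_truncation:
  assumes "strict_mono f" and "n \<le> m"
  shows "fps_X ^ n dvd signed_series f - (\<Sum>s<m. (- fps_X) ^ f s)"
  unfolding fps_X_power_dvd_iff
proof (intro allI impI)
  fix i assume "i < n"
  have nth: "(- fps_X :: int fps) ^ k $ i = (if i = k then (- 1) ^ i else 0)" for k
  proof -
    have "(- fps_X :: int fps) ^ k = fps_const ((- 1) ^ k) * fps_X ^ k"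
      by (subst power_minus) (simp flip: fps_const_power fps_const_neg)
    thus ?thesis by simp
  qed
  have "(\<Sum>s<m. (- fps_X :: int fps) ^ f s $ i) = (if i \<in> range f then (- 1) ^ i else 0)"
  proof (cases "i \<in> range f")
    case True
    then obtain t where t: "i = f t" by blast
    hence "t < m"
      using strict_mono_imp_increasing[OF assms(1), of t] \<open>i < n\<close> assms(2) by linarith
    moreover have "(i = f s) = (s = t)" for s
      using t strict_mono_eq[OF assms(1)] by auto
    ultimately show ?thesis
      using True by (simp add: nth)
  next
    case False
    thus ?thesis by (auto simp: nth intro!: sum.neutral)
  qed
  thus "(signed_series f - (\<Sum>s<m. (- fps_X) ^ f s)) $ i = 0"
    by (simp add: signed_series_def fps_sum_nth)
qed

lemma strict_mono_triangular: "strict_mono (\<lambda>s. s * (s + 1) div 2 :: nat)"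
proof -
  have "Suc s * (Suc s + 1) = s * (s + 1) + Suc s * 2" for s
    by simp
  hence "Suc s * (Suc s + 1) div 2 = Suc s + s * (s + 1) div 2" for s
    by (simp only: div_mult_self1)
  thus ?thesis by (simp only: strict_mono_Suc_iff) linarith
qed

lemma strict_mono_square_Suc: "strict_mono (\<lambda>s. (Suc s)\<^sup>2)"
  by (simp add: strict_mono_Suc_iff power_strict_mono)

section \<open>Partitions with distinct even parts, by largest part\<close>

definition ped_set :: "nat \<Rightarrow> nat \<Rightarrow> nat multiset set" where
  "ped_set k n = {P. partition_of n P \<and> (\<forall>j. even j \<longrightarrow> count P j \<le> 1) \<and> (\<forall>j\<in>#P. j \<le> k)}"

lemma ped_set_0: "ped_set 0 n = (if n = 0 then {{#}} else {})"
proof -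
  have "P = {#}" if "P \<in> ped_set 0 n" for P
    using that unfolding ped_set_def partition_of_def
    by (metis (mono_tags, lifting) le_zero_eq mem_Collect_eq multiset_nonemptyE)
  moreover have "{#} \<in> ped_set 0 n \<longleftrightarrow> n = 0"
    by (auto simp: ped_set_def partition_of_def)
  ultimately show ?thesis by auto
qed

text \<open>Split by whether \<open>Suc k\<close> is a part. After one copy is removed, further
  copies may remain if \<open>Suc k\<close> is odd, but not if it is even.\<close>

lemma ped_set_Suc:
  "ped_set (Suc k) n = ped_set k n \<union>
     (if Suc k \<le> n then add_mset (Suc k) ` ped_set (if even k then Suc k else k) (n - Suc k) else {})"
proof (intro equalityI subsetI)
  fix P assume P: "P \<in> ped_set (Suc k) n"
  show "P \<in> ped_set k n \<union>
     (if Suc k \<le> n then add_mset (Suc k) ` ped_set (if even k then Suc k else k) (n - Suc k) else {})"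
  proof (cases "Suc k \<in># P")
    case False
    hence "P \<in> ped_set k n"
      using P unfolding ped_set_def by (auto simp: le_Suc_eq)
    thus ?thesis by simp
  next
    case True
    then obtain R where R: "P = add_mset (Suc k) R" by (metis multi_member_split)
    have sum: "Suc k \<le> n" "sum_mset R = n - Suc k"
      using P R by (auto simp: ped_set_def partition_of_def)
    have cnt: "count R j \<le> 1" if "even j" for j
    proof -
      have "count P j \<le> 1" using P that by (simp add: ped_set_def)
      thus ?thesis by (simp add: R split: if_splits)
    qed
    have le: "j \<le> (if even k then Suc k else k)" if "j \<in># R" for j
    proof -
      have "j \<le> Suc k" using P that by (simp add: ped_set_def R)
      moreover have "j \<noteq> Suc k" if "odd k"
      proof
        assume "j = Suc k"
        moreover have "count P (Suc k) \<le> 1" using P that by (simp add: ped_set_def)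
        ultimately show False using \<open>j \<in># R\<close> by (simp add: R count_eq_zero_iff)
      qed
      ultimately show ?thesis by (auto simp: le_Suc_eq)
    qed
    have "R \<in> ped_set (if even k then Suc k else k) (n - Suc k)"
      using P sum cnt le by (auto simp: ped_set_def partition_of_def R simp del: One_nat_def)
    thus ?thesis using sum(1) R by auto
  qed
next
  fix P assume "P \<in> ped_set k n \<union>
     (if Suc k \<le> n then add_mset (Suc k) ` ped_set (if even k then Suc k else k) (n - Suc k) else {})"
  then consider "P \<in> ped_set k n"
    | R where "Suc k \<le> n" "P = add_mset (Suc k) R" "R \<in> ped_set (if even k then Suc k else k) (n - Suc k)"
    by (auto split: if_splits)
  thus "P \<in> ped_set (Suc k) n"
  proof cases
    case 1
    thus ?thesis by (auto simp: ped_set_def)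
  next
    case 2
    have "count R (Suc k) = 0" if "odd k"
      using 2(3) that by (auto simp: ped_set_def count_eq_zero_iff)
    hence "count P j \<le> 1" if "even j" for j
      using 2(2,3) that by (auto simp: ped_set_def)
    moreover have "j \<le> Suc k" if "j \<in># P" for j
      using 2(2,3) that by (auto simp: ped_set_def split: if_splits)
    ultimately show ?thesis
      using 2 by (auto simp: ped_set_def partition_of_def)
  qed
qed

lemma finite_ped_set: "finite (ped_set k n)"
proof (induction k arbitrary: n)
  case 0
  then show ?case by (simp add: ped_set_0)
next
  case (Suc k)
  then show ?case
  \<comment> \<open>For even \<open>k\<close> the recursion keeps the bound \<open>Suc k\<close> and
    decreases only \<open>n\<close>, hence the inner induction.\<close>
  proof (induction n rule: less_induct)
    case (less n)
    then show ?case by (subst ped_set_Suc) auto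
  qed
qed

definition ped_upto :: "nat \<Rightarrow> int fps" where
  "ped_upto k = Abs_fps (\<lambda>n. int (card (ped_set k n)))"

lemma ped_upto_0: "ped_upto 0 = 1"
  by (rule fps_ext) (simp add: ped_upto_def ped_set_0)

text \<open>For even \<open>k\<close> the new series occurs on both sides, which encodes the factor
  \<open>1 / (1 - q^(k+1))\<close> without division; for odd \<open>k\<close> the factor is
  \<open>1 + q^(k+1)\<close>.\<close>

lemma ped_upto_Suc:
  "ped_upto (Suc k) = ped_upto k + fps_X ^ Suc k * ped_upto (if even k then Suc k else k)"
proof (rule fps_ext)
  fix n
  let ?A = "if Suc k \<le> n then add_mset (Suc k) ` ped_set (if even k then Suc k else k) (n - Suc k) else {}"
  have "ped_set k n \<inter> ?A = {}" by (auto simp: ped_set_def)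
  hence "card (ped_set (Suc k) n) = card (ped_set k n) + card ?A"
    unfolding ped_set_Suc[of k n] by (intro card_Un_disjoint) (auto simp: finite_ped_set)
  moreover have "card ?A = (if Suc k \<le> n then card (ped_set (if even k then Suc k else k) (n - Suc k)) else 0)"
    by (simp add: card_image inj_on_def)
  ultimately show "ped_upto (Suc k) $ n
    = (ped_upto k + fps_X ^ Suc k * ped_upto (if even k then Suc k else k)) $ n"
    by (simp add: ped_upto_def fps_X_power_mult_nth del: power_Suc)
qed

lemma ped_upto_nth:
  assumes "n \<le> k"
  shows "ped_upto k $ n = int (ped n)"
proof -
  have "j \<le> k" if "partition_of n P" "j \<in># P" for j P
    using that assms by (auto simp: partition_of_def dest!: multi_member_split)
  hence "ped_set k n = {P. partition_of n P \<and> (\<forall>k. even k \<longrightarrow> count P k \<le> 1)}"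
    by (auto simp: ped_set_def)
  thus ?thesis by (simp add: ped_upto_def ped_def)
qed

text \<open>Finite product form of the quotient of theta series. Adding an odd and an even part size
  cancels one factor \<open>1 - ?a\<close> against \<open>ped_upto\<close> and one factor
  \<open>1 + ?b\<close> against its inverse.\<close>

lemma ped_upto_product:
  fixes v :: "nat \<Rightarrow> int fps"
  assumes v: "\<And>j. (1 + fps_X ^ Suc j) * v j = 1"
  shows "ped_upto (2 * n) * (\<Prod>j\<in>{0..<2 * n}. (1 - fps_X ^ Suc j) * v j)
    = (\<Prod>j\<in>{0..<n}. (1 - fps_X ^ (2 * j + 2)) * v (2 * j))"
proof (induction n)
  case 0
  then show ?case by (simp add: ped_upto_0)
next
  case (Suc n)
  let ?Q = "\<Prod>j\<in>{0..<2 * n}. (1 - fps_X ^ Suc j) * v j"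
  let ?a = "fps_X ^ Suc (2 * n) :: int fps" and ?b = "fps_X ^ Suc (Suc (2 * n)) :: int fps"
  have odd: "ped_upto (Suc (2 * n)) * (1 - ?a) = ped_upto (2 * n)"
    using ped_upto_Suc[of "2 * n"] by (simp add: algebra_simps)
  have even: "ped_upto (2 * Suc n) = ped_upto (Suc (2 * n)) * (1 + ?b)"
    using ped_upto_Suc[of "Suc (2 * n)"] by (simp add: algebra_simps)
  have "ped_upto (2 * Suc n) * (\<Prod>j\<in>{0..<2 * Suc n}. (1 - fps_X ^ Suc j) * v j)
     = ped_upto (Suc (2 * n)) * (1 + ?b) * (?Q * ((1 - ?a) * v (2 * n)) * ((1 - ?b) * v (Suc (2 * n))))"
    unfolding even by (simp add: mult.assoc del: power_Suc)
  also have "\<dots> = (ped_upto (Suc (2 * n)) * (1 - ?a)) * ?Q * ((1 - ?b) * v (2 * n))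
      * ((1 + ?b) * v (Suc (2 * n)))"
    by (simp only: ac_simps)
  also have "\<dots> = ped_upto (2 * n) * ?Q * ((1 - ?b) * v (2 * n))"
    by (simp only: odd v mult_1_right)
  finally show ?case
    by (simp add: Suc.IH del: power_Suc)
qed

lemma ped_theta_identity:
  "Abs_fps (\<lambda>n. int (ped n)) * (1 + 2 * signed_series (\<lambda>s. (Suc s)\<^sup>2))
    = signed_series (\<lambda>s. s * (s + 1) div 2)" (is "?D * (1 + 2 * ?S) = ?\<Psi>")
proof -
  have "\<exists>u. (1 + fps_X ^ Suc j :: int fps) * u = 1" for j
    using fps_right_inverse[where f = "1 + fps_X ^ Suc j :: int fps" and y = 1] by auto
  then obtain v where v: "\<And>j. (1 + fps_X ^ Suc j :: int fps) * v j = 1" by metis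
  \<comment> \<open>At \<open>z = -q\<close> the inverses for the triangular identity are the
    even-indexed \<open>v\<close>, so both finite identities share one family.\<close>
  have w: "(1 - (- fps_X) ^ (2 * j + 1) :: int fps) * v (2 * j) = 1" for j
    using v[of "2 * j"] by (simp add: power_minus_odd)
  have dvd: "fps_X ^ n dvd ?D * (1 + 2 * ?S) - ?\<Psi>" for n
  proof -
    define Q where "Q s m = (\<Prod>j\<in>{s..<m}. (1 - fps_X ^ Suc j) * v j)" for s m
    define P where "P s m = (\<Prod>j\<in>{s..<m}. (1 - (- fps_X) ^ (2 * j + 2)) * v (2 * j))" for s m
    have P: "P 0 n = ped_upto (2 * n) * Q 0 (2 * n)"
      unfolding P_def Q_def ped_upto_product[OF v] by (simp add: power_minus_even)
    have D: "fps_X ^ n dvd ?D - ped_upto (2 * n)"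
      by (simp add: fps_X_power_dvd_iff ped_upto_nth)
    have S: "fps_X ^ n dvd (1 + 2 * ?S) - Q 0 (2 * n)"
    proof -
      let ?A = "\<Sum>s<2 * n. (- fps_X) ^ ((Suc s)\<^sup>2) :: int fps"
      have A: "?A = (\<Sum>s<2 * n. (- 1) ^ Suc s * fps_X ^ ((Suc s)\<^sup>2))"
      proof (rule sum.cong)
        fix s
        have "(- 1) ^ ((Suc s)\<^sup>2) = ((- 1) ^ Suc s :: int fps)"
          by (simp add: minus_one_power_iff)
        thus "(- fps_X :: int fps) ^ ((Suc s)\<^sup>2) = (- 1) ^ Suc s * fps_X ^ ((Suc s)\<^sup>2)"
          by (simp only: power_minus[of fps_X])
      qed simp
      have "fps_X ^ n dvd (\<Sum>s<2 * n. (- 1) ^ Suc s * (Q (Suc s) (2 * n) * fps_X ^ (Suc (2 * n) * Suc s) * v s))"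
        by (intro dvd_sum dvd_mult dvd_mult2 le_imp_power_dvd) simp
      hence "fps_X ^ n dvd 2 * (?S - ?A)
         + 2 * (\<Sum>s<2 * n. (- 1) ^ Suc s * (Q (Suc s) (2 * n) * fps_X ^ (Suc (2 * n) * Suc s) * v s))"
        by (intro dvd_add dvd_mult signed_series_truncation strict_mono_square_Suc) simp_all
      also have "\<dots> = (1 + 2 * ?S) - Q 0 (2 * n)"
        using square_theta_finite[OF v, of "2 * n"]
        unfolding A Q_def[symmetric] by (simp add: algebra_simps)
      finally show ?thesis .
    qed
    have \<Psi>: "fps_X ^ n dvd ?\<Psi> - P 0 n"
    proof (cases n)
      case (Suc k)
      let ?B = "\<Sum>s<2 * n. (- fps_X) ^ (s * (s + 1) div 2) :: int fps"
      have "fps_X ^ n dvd (- fps_X :: int fps) ^ (Suc s * (2 * n + 1))" for s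
        by (subst power_minus) (intro dvd_mult le_imp_power_dvd, simp)
      hence "fps_X ^ n dvd (\<Sum>s<k. P (Suc s) n * (- fps_X) ^ (Suc s * (2 * n + 1)))"
        by (intro dvd_sum dvd_mult)
      hence "fps_X ^ n dvd (?\<Psi> - ?B) + (\<Sum>s<k. P (Suc s) n * (- fps_X) ^ (Suc s * (2 * n + 1)))"
        by (intro dvd_add signed_series_truncation strict_mono_triangular) simp_all
      also have "?B = P 0 n + (\<Sum>s<k. P (Suc s) n * (- fps_X) ^ (Suc s * (2 * n + 1)))"
        unfolding triangular_theta_finite[where z = "- fps_X :: int fps" and w = "\<lambda>j. v (2 * j)", OF w]
          P_def[symmetric]
        by (subst (2) Suc) (simp add: sum.lessThan_Suc_shift del: power_Suc sum.lessThan_Suc)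
      finally show ?thesis by simp
    qed simp
    \<comment> \<open>The product identity for the truncations is exact, so only three truncation
      errors remain, each divisible by \<open>fps_X ^ n\<close>.\<close>
    have "?D * (1 + 2 * ?S) - ?\<Psi> = (?D - ped_upto (2 * n)) * (1 + 2 * ?S)
        + ped_upto (2 * n) * ((1 + 2 * ?S) - Q 0 (2 * n)) - (?\<Psi> - P 0 n)"
      unfolding P by (simp add: algebra_simps)
    thus ?thesis
      using dvd_diff[OF dvd_add[OF dvd_mult2[OF D] dvd_mult[OF S]] \<Psi>] by (simp only:)
  qed
  have "?D * (1 + 2 * ?S) - ?\<Psi> = 0"
  proof (rule fps_ext)
    fix i
    show "(?D * (1 + 2 * ?S) - ?\<Psi>) $ i = 0 $ i"
      using dvd[of "Suc i"] unfolding fps_X_power_dvd_iff by (metis fps_zero_nth lessI)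
  qed
  thus ?thesis by simp
qed

section \<open>Divisibility by 8 and quadratic forms\<close>

lemma ped_dvd_8:
  assumes form8: "\<And>x y. 8 * n + 1 \<noteq> x\<^sup>2 + 8 * y\<^sup>2"
    and form16: "\<And>x y. 8 * n + 1 \<noteq> x\<^sup>2 + 16 * y\<^sup>2"
  shows "8 dvd ped n"
proof -
  define D S \<Psi> where "D = Abs_fps (\<lambda>n. int (ped n))"
    and "S = signed_series (\<lambda>s. (Suc s)\<^sup>2)" and "\<Psi> = signed_series (\<lambda>s. s * (s + 1) div 2)"
  have \<Psi>_nz: "\<exists>x. 8 * i + 1 = x\<^sup>2" if "\<Psi> $ i \<noteq> 0" for i
  proof -
    from that obtain s where "i = s * (s + 1) div 2"
      by (auto simp: \<Psi>_def signed_series_def split: if_splits)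
    moreover have "even (s * (s + 1))" by simp
    ultimately have "2 * i = s * (s + 1)" by (simp only: dvd_mult_div_cancel)
    hence "8 * i + 1 = (2 * s + 1)\<^sup>2" by (simp add: power2_eq_square algebra_simps)
    thus ?thesis by blast
  qed
  have S_nz: "\<exists>y. i = y\<^sup>2" if "S $ i \<noteq> 0" for i
    using that by (auto simp: S_def signed_series_def split: if_splits)
  \<comment> \<open>Modulo 8 the inverse of \<open>1 + 2 * S\<close> is \<open>1 - 2 * S + 4 * S\<^sup>2\<close>.\<close>
  have "D * (1 + 2 * S) = \<Psi>"
    unfolding D_def S_def \<Psi>_def by (rule ped_theta_identity)
  hence "D * (1 + 2 * S) * (1 - 2 * S + 4 * (S * S)) = \<Psi> * (1 - 2 * S + 4 * (S * S))"
    by simp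
  \<comment> \<open>The exact remainder comes from
    \<open>(1 + 2 S)(1 - 2 S + 4 S^2) = 1 + 8 S^3\<close>.\<close>
  hence eq: "D = \<Psi> - fps_const 2 * (\<Psi> * S) + fps_const 4 * (\<Psi> * (S * S)) - fps_const 8 * (D * (S * S * S))"
    by (simp add: algebra_simps flip: numeral_fps_const)
  have "\<Psi> $ n = 0"
    using \<Psi>_nz[of n] form8[of _ 0] by auto
  moreover have "(\<Psi> * S) $ n = 0"
    unfolding fps_mult_nth
  proof (rule sum.neutral, rule ballI)
    fix i assume "i \<in> {0..n}"
    hence n: "8 * n + 1 = (8 * i + 1) + 8 * (n - i)" by simp
    show "\<Psi> $ i * S $ (n - i) = 0"
      using \<Psi>_nz[of i] S_nz[of "n - i"] form8 n by (metis mult_eq_0_iff)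
  qed
  \<comment> \<open>An odd coefficient of \<open>S * S\<close> at \<open>n - i\<close> would force
    \<open>n - i = 2 y^2\<close>, which is where the form with 16 arises.\<close>
  moreover have "even ((\<Psi> * (S * S)) $ n)"
    unfolding fps_mult_nth[of \<Psi>]
  proof (rule dvd_sum)
    fix i assume "i \<in> {0..n}"
    hence n: "8 * n + 1 = (8 * i + 1) + 8 * (n - i)" by simp
    show "even (\<Psi> $ i * (S * S) $ (n - i))"
    proof (cases "\<Psi> $ i = 0")
      case False
      then obtain x where x: "8 * i + 1 = x\<^sup>2" using \<Psi>_nz by blast
      have "S $ j = 0" if "n - i = 2 * j" for j
      proof (rule ccontr)
        assume "S $ j \<noteq> 0"
        then obtain y where "j = y\<^sup>2" using S_nz by blast
        hence "8 * n + 1 = x\<^sup>2 + 16 * y\<^sup>2" using n x that by simp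
        thus False using form16 by blast
      qed
      thus ?thesis by (intro dvd_mult even_fps_square_nth)
    qed simp
  qed
  then obtain k where "(\<Psi> * (S * S)) $ n = 2 * k" by blast
  ultimately have "D $ n = 8 * k - 8 * (D * (S * S * S)) $ n"
    by (subst eq) simp
  hence "D $ n = 8 * (k - (D * (S * S * S)) $ n)"
    by (simp only: right_diff_distrib)
  hence "8 dvd D $ n" by (rule dvdI)
  hence "int 8 dvd int (ped n)" by (simp only: D_def fps_nth_Abs_fps of_nat_numeral)
  thus ?thesis by (simp only: int_dvd_int_iff)
qed

section \<open>Quadratic residues and odd powers of p\<close>

text \<open>Gauss's lemma: for \<open>p = 8 k + 7\<close>, the doubles of
  \<open>1, ..., 4 k + 3\<close> stay below \<open>p\<close>, and those exceeding
  \<open>4 k + 3\<close> come from \<open>2 k + 2, ..., 4 k + 3\<close>, an even number of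
  them.\<close>

lemma two_power_half_cong_1:
  assumes "prime p" and "[p = 7] (mod 8)"
  shows "[2 ^ ((p - 1) div 2) = 1] (mod p)"
proof -
  from assms(2) have "p mod 8 = 7" by (simp add: cong_def)
  then obtain k where p: "p = 8 * k + 7" by (metis div_mult_mod_eq mult.commute)
  have "\<not> [2 = 0] (mod int p)"
    by (rule notI) (use p in \<open>simp add: cong_def\<close>)
  then interpret GAUSS p 2
    using assms(1) p by unfold_locales auto
  have half: "(int p - 1) div 2 = 4 * int k + 3" using p by simp
  have C: "C = (\<lambda>x. 2 * x) ` {1..4 * int k + 3}"
  proof -
    have "C = (\<lambda>x. (x * 2) mod int p) ` {0<..4 * int k + 3}"
      by (simp add: C_def B_def A_def half image_image)
    also have "\<dots> = (\<lambda>x. 2 * x) ` {1..4 * int k + 3}"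
      by (intro image_cong) (auto simp: p)
    finally show ?thesis .
  qed
  have "E = (\<lambda>x. 2 * x) ` {2 * int k + 2..4 * int k + 3}"
    unfolding E_def C half by (auto simp: image_iff)
  hence "card E = card {2 * int k + 2..4 * int k + 3}"
    by (simp add: card_image inj_on_def)
  hence "even (card E)" by (simp add: even_nat_iff nat_add_distrib)
  with pre_gauss_lemma have "[2 ^ nat ((int p - 1) div 2) = 1] (mod int p)" by simp
  moreover have "nat ((int p - 1) div 2) = (p - 1) div 2" using p by simp
  ultimately have "[int (2 ^ ((p - 1) div 2)) = int 1] (mod int p)" by simp
  thus ?thesis by (simp only: cong_int_iff)
qed

text \<open>The hypotheses make \<open>-c\<close> a non-residue: if \<open>p\<close> did not divide
  \<open>y\<close>, raising \<open>x^2 = -c y^2\<close> to the odd power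
  \<open>(p - 1) div 2\<close> would give \<open>1 = -1\<close> modulo \<open>p\<close> by
  Fermat.\<close>

lemma prime_dvd_sum_squares_form:
  fixes x y :: int
  assumes "prime p" "odd ((p - 1) div 2)" "\<not> int p dvd c" "[c ^ ((p - 1) div 2) = 1] (mod int p)"
    and dvd: "int p dvd x\<^sup>2 + c * y\<^sup>2"
  shows "int p dvd x \<and> int p dvd y"
proof -
  define h where "h = (p - 1) div 2"
  have p: "prime (int p)" using assms(1) by simp
  have "odd p"
    using assms(1,2) primes_dvd_imp_eq[OF two_is_prime_nat assms(1)] by fastforce
  hence p1: "p - 1 = 2 * h"
    by (simp add: h_def)
  have fermat: "[z ^ (2 * h) = 1] (mod int p)" if "\<not> int p dvd z" for z :: int
  proof -
    have "\<not> p dvd nat \<bar>z\<bar>"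
      using that by (simp add: dvd_nat_abs_iff)
    hence "[int (nat \<bar>z\<bar> ^ (p - 1)) = int 1] (mod int p)"
      using fermat_theorem assms(1) cong_int_iff by blast
    thus ?thesis
      unfolding p1 by (simp add: power_mult)
  qed
  have "int p dvd y"
  proof (rule ccontr)
    assume y: "\<not> int p dvd y"
    hence x: "\<not> int p dvd x"
      using dvd p assms(3) by (metis dvd_add_right_iff dvd_mult2 power2_eq_square prime_dvd_mult_iff prime_dvd_power)
    have "[x\<^sup>2 = - (c * y\<^sup>2)] (mod int p)"
      using dvd by (simp add: cong_iff_dvd_diff)
    hence "[(x\<^sup>2) ^ h = (- (c * y\<^sup>2)) ^ h] (mod int p)" by (rule cong_pow)
    moreover have "(- (c * y\<^sup>2)) ^ h = - (c ^ h * y ^ (2 * h))"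
      using assms(2) by (simp add: h_def power_minus_odd power_mult_distrib power_mult)
    moreover have "[- (c ^ h * y ^ (2 * h)) = - (1 * 1)] (mod int p)"
      using fermat[OF y] assms(4) by (intro cong_minus_minus_iff[THEN iffD2] cong_mult) (simp_all add: h_def)
    ultimately have "[1 = - 1] (mod int p)"
      using fermat[OF x] by (metis cong_sym cong_trans mult_1 power_mult)
    hence "int p dvd 2" by (simp add: cong_iff_dvd_diff)
    thus False using \<open>odd p\<close> assms(1)
      by (metis dvd_refl even_of_nat prime_prime_factor primes_dvd_imp_eq two_is_prime_nat int_dvd_int_iff of_nat_numeral)
  qed
  moreover from this dvd have "int p dvd x\<^sup>2"
    by (metis dvd_add_left_iff dvd_mult dvd_mult2 power2_eq_square)
  ultimately show ?thesis using p prime_dvd_power by blast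
qed

text \<open>Descent: \<open>p\<close> divides both \<open>x\<close> and \<open>y\<close>, so
  \<open>p^2\<close> cancels and the odd exponent drops by 2. At exponent 1 this would force
  \<open>p\<close> to divide \<open>m\<close>.\<close>

lemma odd_prime_power_not_represented:
  fixes x y :: int
  assumes "prime p" "odd ((p - 1) div 2)" "\<not> int p dvd c" "[c ^ ((p - 1) div 2) = 1] (mod int p)"
    and "\<not> p dvd m"
  shows "x\<^sup>2 + c * y\<^sup>2 \<noteq> int (p ^ (2 * a + 1) * m)"
proof (induction a arbitrary: x y)
  case (0 x y)
  show ?case
  proof
    assume eq: "x\<^sup>2 + c * y\<^sup>2 = int (p ^ (2 * 0 + 1) * m)"
    hence "int p dvd x\<^sup>2 + c * y\<^sup>2" by simp
    then obtain u v where "x = int p * u" "y = int p * v"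
      using prime_dvd_sum_squares_form[OF assms(1-4)] unfolding dvd_def by blast
    with eq have "int p * (int p * (u\<^sup>2 + c * v\<^sup>2)) = int p * int m"
      by (simp add: power2_eq_square algebra_simps)
    hence "int p * (u\<^sup>2 + c * v\<^sup>2) = int m"
      using assms(1) prime_gt_0_nat[of p] by (subst (asm) mult_cancel_left) auto
    hence "int p dvd int m" by (metis dvd_triv_left)
    thus False using assms(5) by simp
  qed
next
  case (Suc a x y)
  show ?case
  proof
    assume eq: "x\<^sup>2 + c * y\<^sup>2 = int (p ^ (2 * Suc a + 1) * m)"
    hence "int p dvd x\<^sup>2 + c * y\<^sup>2" by simp
    then obtain u v where "x = int p * u" "y = int p * v"
      using prime_dvd_sum_squares_form[OF assms(1-4)] unfolding dvd_def by blast
    with eq have "int p ^ 2 * (u\<^sup>2 + c * v\<^sup>2) = int p ^ 2 * int (p ^ (2 * a + 1) * m)"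
      by (simp add: power2_eq_square algebra_simps)
    hence "u\<^sup>2 + c * v\<^sup>2 = int (p ^ (2 * a + 1) * m)"
      using assms(1) prime_gt_0_nat[of p] by (subst (asm) mult_cancel_left) auto
    with Suc.IH show False by blast
  qed
qed

theorem theorem1p2:
  fixes p r n \<alpha> :: nat
  assumes "prime p"
    and "[p = 7] (mod 8)"
    and "1 \<le> r" and "r < 8 * p"
    and "[r * p = 1] (mod 8)"
    and "gcd r p = 1"
  shows "[ped (p ^ (2 * \<alpha> + 2) * n + (r * p ^ (2 * \<alpha> + 1) - 1) div 8) = 0] (mod 8)"
proof -
  define N where "N = p ^ (2 * \<alpha> + 2) * n + (r * p ^ (2 * \<alpha> + 1) - 1) div 8"
  \<comment> \<open>The cofactor of \<open>p ^ (2 * \<alpha> + 1)\<close> in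
    \<open>8 * N + 1\<close>; it is prime to \<open>p\<close> because \<open>r\<close> is.\<close>
  define m where "m = 8 * p * n + r"
  have p7: "p mod 8 = 7" using assms(2) by (simp add: cong_def)
  have odd_half: "odd ((p - 1) div 2)"
  proof -
    obtain k where "p = 8 * k + 7" using p7 by (metis div_mult_mod_eq mult.commute)
    thus ?thesis by simp
  qed
  have "odd p" using p7 by presburger
  have m: "\<not> p dvd m"
  proof
    assume "p dvd m"
    hence "p dvd r" by (auto simp: m_def dvd_add_right_iff)
    hence "p dvd gcd r p" by simp
    thus False using assms(1,6) by (simp add: not_prime_unit)
  qed
  have N: "8 * N + 1 = p ^ (2 * \<alpha> + 1) * m"
  proof -
    \<comment> \<open>Hence \<open>r * p ^ (2 * \<alpha> + 1)\<close> is congruent to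
      \<open>r * p\<close>, that is to 1, and the division by 8 is exact.\<close>
    have "[p * p = 1] (mod 8)"
      using cong_mult[OF assms(2) assms(2)] by (simp add: cong_def)
    hence "[r * p * (p * p) ^ \<alpha> = 1 * 1 ^ \<alpha>] (mod 8)"
      by (intro cong_mult cong_pow assms(5))
    hence "[r * p ^ (2 * \<alpha> + 1) = 1] (mod 8)"
      by (simp add: power_mult power2_eq_square power_mult_distrib mult_ac)
    hence "8 dvd r * p ^ (2 * \<alpha> + 1) - 1"
      by (rule cong_to_1_nat)
    moreover have "r * p ^ (2 * \<alpha> + 1) \<ge> 1"
      using assms(1,3) prime_gt_0_nat by (simp add: Suc_le_eq)
    ultimately have "8 * ((r * p ^ (2 * \<alpha> + 1) - 1) div 8) + 1 = r * p ^ (2 * \<alpha> + 1)"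
      by (simp only: dvd_mult_div_cancel le_add_diff_inverse2)
    moreover have "8 * (p ^ (2 * \<alpha> + 2) * n) = p ^ (2 * \<alpha> + 1) * (8 * p * n)"
      by simp
    ultimately show ?thesis
      unfolding N_def m_def distrib_left add.assoc by (simp only: mult.commute)
  qed
  \<comment> \<open>Both forms are treated at once, with \<open>e = 3\<close> and
    \<open>e = 4\<close>: every power of 2 inherits the residue property of 2.\<close>
  have no_rep: "8 * N + 1 \<noteq> x\<^sup>2 + 2 ^ e * y\<^sup>2" for e x y
  proof
    assume eq: "8 * N + 1 = x\<^sup>2 + 2 ^ e * y\<^sup>2"
    have "\<not> int p dvd 2 ^ e"
    proof
      assume "int p dvd 2 ^ e"
      hence "int p dvd int 2"
        using prime_dvd_power[of "int p" 2 e] assms(1) by simp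
      hence "p dvd 2" by (simp only: int_dvd_int_iff)
      thus False using primes_dvd_imp_eq[OF assms(1) two_is_prime_nat] \<open>odd p\<close> by auto
    qed
    moreover have "[(2 ^ e) ^ ((p - 1) div 2) = 1] (mod int p)"
    proof -
      have "[(2 ^ ((p - 1) div 2)) ^ e = 1 ^ e] (mod p)"
        by (rule cong_pow[OF two_power_half_cong_1[OF assms(1,2)]])
      hence "[int ((2 ^ e) ^ ((p - 1) div 2)) = int 1] (mod int p)"
        unfolding cong_int_iff by (simp add: mult.commute flip: power_mult)
      thus ?thesis by simp
    qed
    ultimately have "(int x)\<^sup>2 + 2 ^ e * (int y)\<^sup>2 \<noteq> int (p ^ (2 * \<alpha> + 1) * m)"
      by (intro odd_prime_power_not_represented assms(1) odd_half m)
    moreover have "(int x)\<^sup>2 + 2 ^ e * (int y)\<^sup>2 = int (x\<^sup>2 + 2 ^ e * y\<^sup>2)" by simp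
    ultimately show False using eq N by metis
  qed
  have "8 dvd ped N"
    by (rule ped_dvd_8) (use no_rep[where e = 3] no_rep[where e = 4] in simp_all)
  thus ?thesis by (simp add: N_def cong_0_iff)
qed

end
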